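(* Let $\alpha,\beta>0$ and let $N_t$ be the self-exciting point process with intensity $\lambda_t=\beta+\alpha\frac{N_{t-}}{t+1}$. If $\alpha\notin\{\frac12,1\}$, then for any $t>s\ge 0$, $$\mathrm{Cov}[N_t,N_s]=(t+1)^{\alpha}\left[\frac{\beta}{(1-2\alpha)(1-\alpha)}(s+1)^{1-\alpha}+\frac{\beta}{1-\alpha}-\frac{2\beta}{1-2\alpha}(s+1)^{\alpha}\right].$$ If $\alpha=\frac12$, then for any $t>s\ge 0$, $$\mathrm{Cov}[N_t,N_s]=2\beta\left[-(t+1)^{\frac12}(s+1)^{\frac12}+(t+1)^{\frac12}+(t+1)^{\frac12}(s+1)^{\frac12}\log(s+1)\right].$$
   Context: $N_t$ is a simple point process on $(0,\infty)$ with $N_0=0$ (empty past history) whose intensity at time $t$ with respect to its natural filtration is $\lambda_t=\lambda\left(\frac{N_{t-}}{t+1}\right)$ with $\lambda(z)=\beta+\alpha z$. *)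

theory Defs
  imports "HOL-Probability.Probability"
begin

text \<open>
  A point process on \<open>(0,\<infinity>)\<close> is represented by its counting process
  \<open>N t \<omega>\<close> = number of points in \<open>(0,t]\<close>. Only times \<open>t \<ge> 0\<close> are meaningful; the values of
  \<open>N\<close> at negative times are never used.
\<close>

definition left_limit :: "(real \<Rightarrow> 'a \<Rightarrow> nat) \<Rightarrow> real \<Rightarrow> 'a \<Rightarrow> nat" where
  "left_limit N t \<omega> = Lim (at_left t) (\<lambda>s. N s \<omega>)"

definition point_process :: "'a measure \<Rightarrow> (real \<Rightarrow> 'a \<Rightarrow> nat) \<Rightarrow> bool" where
  "point_process M N \<longleftrightarrow>
     (\<forall>t\<ge>0. N t \<in> M \<rightarrow>\<^sub>M count_space UNIV) \<and>
     (\<forall>\<omega>\<in>space M. N 0 \<omega> = 0 \<and> mono_on {0..} (\<lambda>t. N t \<omega>) \<and>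
        (\<forall>t\<ge>0. continuous (at_right t) (\<lambda>s. N s \<omega>)))"

definition simple_point_process :: "'a measure \<Rightarrow> (real \<Rightarrow> 'a \<Rightarrow> nat) \<Rightarrow> bool" where
  "simple_point_process M N \<longleftrightarrow>
     point_process M N \<and> (AE \<omega> in M. \<forall>t>0. N t \<omega> \<le> left_limit N t \<omega> + 1)"

definition natural_filtration :: "'a measure \<Rightarrow> (real \<Rightarrow> 'a \<Rightarrow> nat) \<Rightarrow> real \<Rightarrow> 'a measure" where
  "natural_filtration M N t =
     sigma (space M) {N s -` B \<inter> space M | s B. 0 \<le> s \<and> s \<le> t}"

text \<open>The predictable \<open>\<sigma>\<close>-algebra on \<open>(0,\<infinity>) \<times> \<Omega>\<close>.\<close>

definition predictable_sigma :: "'a measure \<Rightarrow> (real \<Rightarrow> 'a measure) \<Rightarrow> (real \<times> 'a) measure" where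
  "predictable_sigma M F =
     sigma ({0<..} \<times> space M)
       {{a<..b} \<times> A | a b A. 0 \<le> a \<and> a \<le> b \<and> A \<in> sets (F a)}"

definition progressively_measurable :: "(real \<Rightarrow> 'a measure) \<Rightarrow> (real \<Rightarrow> 'a \<Rightarrow> real) \<Rightarrow> bool" where
  "progressively_measurable F l \<longleftrightarrow>
     (\<forall>t>0. (\<lambda>(s, \<omega>). l s \<omega>) \<in> borel_measurable (restrict_space borel {0<..t} \<Otimes>\<^sub>M F t))"

text \<open>The random measure \<open>dN\<close>: the Lebesgue--Stieltjes measure of a path, which is extended by
  its initial value to negative times because \<open>interval_measure\<close> expects a function on all
  of \<open>\<real>\<close>.\<close>

definition path_measure :: "(real \<Rightarrow> 'a \<Rightarrow> nat) \<Rightarrow> 'a \<Rightarrow> real measure" where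
  "path_measure N \<omega> = interval_measure (\<lambda>t. real (N (max 0 t) \<omega>))"

text \<open>
  Stochastic intensity in the sense of Bremaud: \<open>l\<close> is nonnegative, progressively measurable,
  a.s. locally integrable, and \<open>E \<integral> C dN = E \<integral> C\<^sub>s l\<^sub>s ds\<close> for every nonnegative predictable
  \<open>C\<close>. Testing against predictable \<open>C\<close>, rather than only asking
  \<open>E[N(a,b] | F\<^sub>a] = E[\<integral>\<^sub>a\<^sup>b l\<^sub>s ds | F\<^sub>a]\<close>, determines the law of \<open>N\<close> without an a priori
  assumption that \<open>E N\<^sub>t\<close> is finite.
\<close>

definition has_intensity ::
    "'a measure \<Rightarrow> (real \<Rightarrow> 'a measure) \<Rightarrow> (real \<Rightarrow> 'a \<Rightarrow> nat) \<Rightarrow> (real \<Rightarrow> 'a \<Rightarrow> real) \<Rightarrow> bool" where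
  "has_intensity M F N l \<longleftrightarrow>
     (\<forall>t>0. \<forall>\<omega>\<in>space M. 0 \<le> l t \<omega>) \<and>
     progressively_measurable F l \<and>
     (AE \<omega> in M. \<forall>t>0. (\<integral>\<^sup>+s\<in>{0<..t}. ennreal (l s \<omega>) \<partial>lborel) < \<infinity>) \<and>
     (\<forall>C :: real \<times> 'a \<Rightarrow> ennreal. C \<in> borel_measurable (predictable_sigma M F) \<longrightarrow>
        (\<integral>\<^sup>+\<omega>. (\<integral>\<^sup>+s\<in>{0<..}. C (s, \<omega>) \<partial>path_measure N \<omega>) \<partial>M) =
        (\<integral>\<^sup>+\<omega>. (\<integral>\<^sup>+s\<in>{0<..}. C (s, \<omega>) * ennreal (l s \<omega>) \<partial>lborel) \<partial>M))"

definition covariance :: "'a measure \<Rightarrow> ('a \<Rightarrow> real) \<Rightarrow> ('a \<Rightarrow> real) \<Rightarrow> real" where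
  "covariance M X Y =
     (\<integral>\<omega>. (X \<omega> - (\<integral>\<omega>'. X \<omega>' \<partial>M)) * (Y \<omega> - (\<integral>\<omega>'. Y \<omega>' \<partial>M)) \<partial>M)"

end

theory Submission
  imports Defs
begin

text \<open>
  Testing the intensity against the predictable integrand
  \<open>1\<^bsub>(a,b]\<^esub>(s) h(N\<^sub>a) d(N\<^bsub>s-\<^esub>)\<close> gives, since all jumps have size one,
  \<open>E[h(N\<^sub>a) \<Sum>\<^bsub>N\<^sub>a \<le> j < N\<^sub>b\<^esub> d(j)] = \<integral>\<^sub>a\<^sup>b E[h(N\<^sub>a) d(N\<^sub>s) (\<beta> + \<alpha> N\<^sub>s / (s + 1))] ds\<close>.
  Taking \<open>d(j) = 2 j + 1\<close> for \<open>j < K\<close> and \<open>0\<close> otherwise, Gronwall's inequality bounds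
  \<open>E[min(N\<^sub>t, K)\<^sup>2]\<close> uniformly in \<open>K\<close>, so second moments are finite. Then \<open>d = 1\<close> and \<open>d(j) = 2 j + 1\<close>
  (with \<open>a = 0\<close>, \<open>h = 1\<close>) and \<open>d = 1\<close>, \<open>h(n) = n\<close> give linear integral equations for \<open>E[N\<^sub>t]\<close>,
  \<open>E[N\<^sub>t\<^sup>2]\<close> and \<open>E[N\<^sub>s N\<^sub>t]\<close>. Their solutions are unique: with \<open>m\<close> the mean and \<open>v\<close> the variance,
  \<open>m' = \<beta> + \<alpha> m / (t + 1)\<close> and \<open>v' = m' + 2 \<alpha> v / (t + 1)\<close>, while the covariance is
  \<open>((t + 1) / (s + 1))\<^sup>\<alpha> v(s)\<close>.
\<close>

subsection \<open>Gronwall's inequality and linear integral equations\<close>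

lemma nn_integral_mono_on:
  assumes "\<And>x. x \<in> A \<Longrightarrow> f x \<le> g x"
  shows "(\<integral>\<^sup>+x\<in>A. f x \<partial>M) \<le> (\<integral>\<^sup>+x\<in>A. g x \<partial>M)"
  using assms by (intro nn_integral_mono) (auto simp: indicator_def)

lemma nn_integral_cong_on:
  assumes "\<And>x. x \<in> A \<Longrightarrow> f x = g x"
  shows "(\<integral>\<^sup>+x\<in>A. f x \<partial>M) = (\<integral>\<^sup>+x\<in>A. g x \<partial>M)"
  using assms by (intro nn_integral_cong) (auto simp: indicator_def)

text \<open>A single endpoint is a Lebesgue null set. Point-process identities come on half-open
  intervals, the fundamental theorem of calculus on closed ones.\<close>

lemma nn_integral_Ioc_eq_Icc:
  fixes a b :: real and f :: "real \<Rightarrow> ennreal"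
  shows "(\<integral>\<^sup>+s\<in>{a<..b}. f s \<partial>lborel) = (\<integral>\<^sup>+s\<in>{a..b}. f s \<partial>lborel)"
  using AE_lborel_singleton[of a] by (intro nn_integral_cong_AE) (auto simp: indicator_def)

text \<open>The supremum of \<open>g\<close> weighted by \<open>exp (- 2 * c * (s - a))\<close> is at most \<open>b * (T - a)\<close> plus half of itself.\<close>

lemma gronwall_nn_integral:
  fixes g :: "real \<Rightarrow> real"
  assumes "0 < c" "0 \<le> b"
    and bounded: "\<And>s. a \<le> s \<Longrightarrow> s \<le> T \<Longrightarrow> 0 \<le> g s \<and> g s \<le> B"
    and le: "\<And>t. a \<le> t \<Longrightarrow> t \<le> T \<Longrightarrow> ennreal (g t) \<le> (\<integral>\<^sup>+s\<in>{a<..t}. ennreal (b + c * g s) \<partial>lborel)"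
    and "a \<le> t" "t \<le> T"
  shows "g t \<le> 2 * b * (T - a) * exp (2 * c * (T - a))"
proof -
  let ?A = "(\<lambda>s. g s * exp (- (2 * c * (s - a)))) ` {a..T}"
  define S where "S = Sup ?A"
  have "g s * exp (- (2 * c * (s - a))) \<le> B" if "a \<le> s" "s \<le> T" for s
  proof -
    have "g s * exp (- (2 * c * (s - a))) \<le> g s * 1"
      using bounded[of s] that \<open>0 < c\<close> by (intro mult_left_mono) auto
    with bounded[of s] that show ?thesis by auto
  qed
  \<comment> \<open>Boundedness makes \<open>S\<close> a genuine real supremum, so that
    \<open>S / 2\<close> can be absorbed into the left-hand side at the end.\<close>
  then have bdd: "bdd_above ?A" by (intro bdd_aboveI[of _ B]) auto
  have S: "g s * exp (- (2 * c * (s - a))) \<le> S" if "a \<le> s" "s \<le> T" for s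
    unfolding S_def using that by (intro cSup_upper bdd) auto
  have g_le: "g s \<le> S * exp (2 * c * (s - a))" if "a \<le> s" "s \<le> T" for s
    using mult_right_mono[OF S[OF that], of "exp (2 * c * (s - a))"] by (simp add: mult.assoc flip: exp_add)
  have S0: "0 \<le> S" using S[of t] bounded[of t] assms(5,6) by (meson exp_ge_zero mult_nonneg_nonneg order.trans)
  have "g t * exp (- (2 * c * (t - a))) \<le> b * (T - a) + S / 2" if t: "a \<le> t" "t \<le> T" for t
  proof -
    \<comment> \<open>An antiderivative of the majorant
      \<open>b + c * S * exp (2 * c * (s - a))\<close>. The rate \<open>2 * c\<close> in the weight,
      instead of \<open>c\<close>, is what produces the factor 1/2 in front of
      \<open>S\<close>.\<close>
    let ?F = "\<lambda>s. b * s + S / 2 * exp (2 * c * (s - a))"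
    have "ennreal (g t) \<le> (\<integral>\<^sup>+s\<in>{a<..t}. ennreal (b + c * g s) \<partial>lborel)"
      using le t by simp
    also have "\<dots> \<le> (\<integral>\<^sup>+s. ennreal (b + c * S * exp (2 * c * (s - a))) * indicator {a..t} s \<partial>lborel)"
      unfolding nn_integral_Ioc_eq_Icc
      using g_le t \<open>0 < c\<close> by (intro nn_integral_mono) (auto simp: indicator_def mult.assoc intro!: ennreal_leI)
    also have "\<dots> = ennreal (?F t - ?F a)"
      using assms(1,2) S0 t
      by (intro nn_integral_FTC_Icc) (auto intro!: derivative_eq_intros)
    finally have "ennreal (g t) \<le> ennreal (?F t - ?F a)" .
    \<comment> \<open>These give \<open>0 \<le> ?F t - ?F a\<close>, which is needed to pass from
      the \<open>ennreal\<close> inequality to the real one.\<close>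
    moreover have "b * a \<le> b * t" "S / 2 * 1 \<le> S / 2 * exp (2 * c * (t - a))"
      using assms(1,2) S0 t by (intro mult_left_mono; simp)+
    ultimately have "g t \<le> b * (t - a) + S / 2 * (exp (2 * c * (t - a)) - 1)"
      by (subst (asm) ennreal_le_iff) (auto simp: right_diff_distrib)
    then have "g t * exp (- (2 * c * (t - a))) \<le>
        (b * (t - a) + S / 2 * (exp (2 * c * (t - a)) - 1)) * exp (- (2 * c * (t - a)))"
      by (intro mult_right_mono) auto
    also have "\<dots> = b * (t - a) * exp (- (2 * c * (t - a))) + S / 2 * (1 - exp (- (2 * c * (t - a))))"
      unfolding exp_minus by (simp add: field_simps)
    also have "\<dots> \<le> b * (T - a) * 1 + S / 2 * 1"
      using assms(1,2) S0 t by (intro add_mono mult_mono mult_left_mono) auto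
    finally show ?thesis by simp
  qed
  then have "S \<le> b * (T - a) + S / 2"
    unfolding S_def using assms(5,6) by (intro cSup_least) auto
  then have "S \<le> 2 * b * (T - a)" by simp
  have "g t \<le> S * exp (2 * c * (t - a))" using g_le assms(5,6) by simp
  also have "\<dots> \<le> (2 * b * (T - a)) * exp (2 * c * (T - a))"
    using \<open>S \<le> 2 * b * (T - a)\<close> S0 assms by (intro mult_mono) auto
  finally show ?thesis by simp
qed

text \<open>Monotonicity makes \<open>y\<close> bounded and Borel on \<open>{a..T}\<close>, and
  nonnegativity of \<open>p + q * y\<close> turns its \<open>ennreal\<close> equation into one
  between Bochner integrals. The fundamental theorem of calculus puts \<open>y0\<close> into the
  same form. Gronwall's inequality with \<open>b = 0\<close> then makes the absolute difference of
  \<open>y\<close> and \<open>y0\<close> vanish.\<close>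

lemma linear_integral_equation_unique:
  fixes y y0 p q :: "real \<Rightarrow> real"
  assumes mono: "mono_on {a..} y" and ya: "0 \<le> y a"
    and p: "continuous_on {a..} p" and q: "continuous_on {a..} q"
    and nonneg: "\<And>s. a \<le> s \<Longrightarrow> 0 \<le> p s + q s * y s"
    and y: "\<And>t. a \<le> t \<Longrightarrow>
      ennreal (y t) = ennreal (y a) + (\<integral>\<^sup>+s\<in>{a<..t}. ennreal (p s + q s * y s) \<partial>lborel)"
    and y0: "\<And>t. a \<le> t \<Longrightarrow> (y0 has_real_derivative p t + q t * y0 t) (at t)"
    and y0a: "y0 a = y a"
    and T: "a \<le> T"
  shows "y T = y0 T"
proof -
  have bounded: "\<exists>B. \<forall>s\<in>{a..T}. \<bar>f s\<bar> \<le> B" if "continuous_on {a..} f" for f :: "real \<Rightarrow> real"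
  proof -
    have "continuous_on {a..T} f" using that by (rule continuous_on_subset) auto
    then have "bounded (f ` {a..T})"
      by (intro compact_imp_bounded compact_continuous_image) auto
    then show ?thesis by (auto simp: bounded_iff)
  qed
  have y0_cont: "continuous_on {a..} y0"
    using y0 by (intro continuous_at_imp_continuous_on) (auto intro: DERIV_isCont)
  obtain P where P: "\<And>s. s \<in> {a..T} \<Longrightarrow> \<bar>p s\<bar> \<le> P" using bounded[OF p] by blast
  obtain Q where Q: "\<And>s. s \<in> {a..T} \<Longrightarrow> \<bar>q s\<bar> \<le> Q" using bounded[OF q] by blast
  obtain Y0 where Y0: "\<And>s. s \<in> {a..T} \<Longrightarrow> \<bar>y0 s\<bar> \<le> Y0" using bounded[OF y0_cont] by blast
  have y_bd: "0 \<le> y s \<and> y s \<le> y T" if "s \<in> {a..T}" for s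
    using mono_onD[OF mono, of a s] mono_onD[OF mono, of s T] that ya by auto
  let ?g = "\<lambda>z s. p s + q s * z s"
  \<comment> \<open>The functions are controlled on \<open>{a..}\<close> only; cutting them off by
    an indicator gives measurability on the whole line.\<close>
  have meas: "(\<lambda>s. indicator {a..T} s * z s) \<in> borel_measurable borel"
    if "z \<in> borel_measurable (restrict_space borel {a..})" for z :: "real \<Rightarrow> real"
  proof -
    have "(\<lambda>s. indicator {a..} s *\<^sub>R z s) \<in> borel_measurable borel"
      using that by (subst (asm) borel_measurable_restrict_space_iff) auto
    then have "(\<lambda>s. indicator {a..T} s * (indicator {a..} s *\<^sub>R z s)) \<in> borel_measurable borel"
      by measurable
    then show ?thesis by (rule measurable_cong[THEN iffD1, rotated]) (auto simp: indicator_def)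
  qed
  have restr: "p \<in> borel_measurable (restrict_space borel {a..})"
      "q \<in> borel_measurable (restrict_space borel {a..})"
      "y0 \<in> borel_measurable (restrict_space borel {a..})"
    using p q y0_cont by (auto intro: borel_measurable_continuous_on_restrict)
  have int: "integrable lborel (\<lambda>s. ?g z s * indicator {a..T} s)"
    if z: "z \<in> borel_measurable (restrict_space borel {a..})"
      and Z: "\<And>s. s \<in> {a..T} \<Longrightarrow> \<bar>z s\<bar> \<le> Z" for Z and z :: "real \<Rightarrow> real"
  proof (rule integrableI_bounded_set[where B = "P + Q * Z" and A = "{a..T}"])
    have "?g z \<in> borel_measurable (restrict_space borel {a..})"
      using z restr by measurable
    from meas[OF this] show "(\<lambda>s. ?g z s * indicator {a..T} s) \<in> borel_measurable lborel"
      by (simp add: mult.commute)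
    have "\<bar>?g z s\<bar> \<le> P + Q * Z" if s: "s \<in> {a..T}" for s
    proof -
      have "\<bar>?g z s\<bar> \<le> \<bar>p s\<bar> + \<bar>q s\<bar> * \<bar>z s\<bar>" by (simp add: abs_mult[symmetric])
      also have "\<dots> \<le> P + Q * Z"
        using P[OF s] Q[OF s] Z[OF s] by (intro add_mono mult_mono) auto
      finally show ?thesis .
    qed
    then show "AE s in lborel. s \<in> {a..T} \<longrightarrow> norm (?g z s * indicator {a..T} s) \<le> P + Q * Z"
      by auto
    show "emeasure lborel {a..T} < \<infinity>" using T by simp
  qed auto
  have int_t: "integrable lborel (\<lambda>s. ?g z s * indicator {a..t} s)"
    if "integrable lborel (\<lambda>s. ?g z s * indicator {a..T} s)" "t \<le> T" for z t
  proof -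
    have "integrable lborel (\<lambda>s. indicator {a..t} s *\<^sub>R (?g z s * indicator {a..T} s))"
      using that(1) by (intro integrable_mult_indicator) auto
    then show ?thesis
      by (rule Bochner_Integration.integrable_cong[THEN iffD1, rotated 2])
        (use that(2) in \<open>auto simp: indicator_def\<close>)
  qed
  have y_restr: "y \<in> borel_measurable (restrict_space borel {a..})"
    using mono by (rule borel_measurable_mono_on_fnc)
  have int_y: "integrable lborel (\<lambda>s. ?g y s * indicator {a..T} s)"
    using y_bd by (intro int[OF y_restr, of "y T"]) auto
  have int_y0: "integrable lborel (\<lambda>s. ?g y0 s * indicator {a..T} s)"
    using Y0 by (intro int[OF restr(3)]) auto
  have y_eq: "y t = y a + (\<integral>s. ?g y s * indicator {a..t} s \<partial>lborel)" if t: "a \<le> t" "t \<le> T" for t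
  proof -
    have "(\<integral>\<^sup>+s\<in>{a<..t}. ennreal (?g y s) \<partial>lborel) = (\<integral>\<^sup>+s. ennreal (?g y s * indicator {a..t} s) \<partial>lborel)"
      unfolding nn_integral_Ioc_eq_Icc by (intro nn_integral_cong) (auto simp: indicator_def)
    also have "\<dots> = ennreal (\<integral>s. ?g y s * indicator {a..t} s \<partial>lborel)"
      using nonneg by (intro nn_integral_eq_integral int_t[OF int_y t(2)]) (auto simp: indicator_def)
    finally have "ennreal (y t) = ennreal (y a) + ennreal (\<integral>s. ?g y s * indicator {a..t} s \<partial>lborel)"
      using y[OF t(1)] by simp
    moreover have "0 \<le> (\<integral>s. ?g y s * indicator {a..t} s \<partial>lborel)"
      using nonneg by (intro Bochner_Integration.integral_nonneg) (auto simp: indicator_def)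
    ultimately show ?thesis
      using ya y_bd[of t] t by (simp flip: ennreal_plus)
  qed
  have y0_eq: "y0 t = y0 a + (\<integral>s. ?g y0 s * indicator {a..t} s \<partial>lborel)" if t: "a \<le> t" "t \<le> T" for t
  proof -
    have sub: "{a..t} \<subseteq> {a..}" by auto
    have "(\<integral>s. indicator {a..t} s *\<^sub>R ?g y0 s \<partial>lborel) = y0 t - y0 a"
    proof (rule integral_FTC_Icc[OF t(1)])
      show "(y0 has_vector_derivative ?g y0 s) (at s within {a..t})" if "a \<le> s" "s \<le> t" for s
        using y0[OF that(1)] by (auto simp: has_real_derivative_iff_has_vector_derivative
            intro: has_vector_derivative_at_within)
      show "continuous_on {a..t} (?g y0)"
        using continuous_on_subset[OF p sub] continuous_on_subset[OF q sub]
          continuous_on_subset[OF y0_cont sub] by (intro continuous_intros)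
    qed
    then show ?thesis by (simp add: mult.commute)
  qed
  define D where "D t = \<bar>y t - y0 t\<bar>" for t
  \<comment> \<open>The constant is \<open>max 1 Q\<close> because Gronwall's inequality above asks
    for a positive one and \<open>Q\<close> may be 0.\<close>
  have D_le: "ennreal (D t) \<le> (\<integral>\<^sup>+s\<in>{a<..t}. ennreal (0 + max 1 Q * D s) \<partial>lborel)"
    if t: "a \<le> t" "t \<le> T" for t
  proof -
    note ints = int_t[OF int_y t(2)] int_t[OF int_y0 t(2)]
    have diff: "y t - y0 t =
        (\<integral>s. ?g y s * indicator {a..t} s - ?g y0 s * indicator {a..t} s \<partial>lborel)"
      using y_eq[OF t] y0_eq[OF t] y0a ints by simp
    have "ennreal (D t) \<le>
        (\<integral>\<^sup>+s. ennreal \<bar>?g y s * indicator {a..t} s - ?g y0 s * indicator {a..t} s\<bar> \<partial>lborel)"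
      using integral_norm_bound_ennreal[OF Bochner_Integration.integrable_diff[OF ints]]
      unfolding D_def diff real_norm_def .
    also have "\<dots> \<le> (\<integral>\<^sup>+s\<in>{a..t}. ennreal (0 + max 1 Q * D s) \<partial>lborel)"
    proof (intro nn_integral_mono)
      fix s
      show "ennreal \<bar>?g y s * indicator {a..t} s - ?g y0 s * indicator {a..t} s\<bar> \<le>
          ennreal (0 + max 1 Q * D s) * indicator {a..t} s"
      proof (cases "s \<in> {a..t}")
        case True
        have "?g y s - ?g y0 s = q s * (y s - y0 s)" by (simp add: right_diff_distrib)
        then have "\<bar>?g y s - ?g y0 s\<bar> = \<bar>q s\<bar> * D s" by (simp only: D_def abs_mult)
        also have "\<dots> \<le> max 1 Q * D s"
          using Q[of s] True t by (intro mult_right_mono) (auto simp: D_def)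
        finally show ?thesis using True by (auto intro: ennreal_leI)
      qed auto
    qed
    finally show ?thesis unfolding nn_integral_Ioc_eq_Icc .
  qed
  have "D T \<le> 2 * 0 * (T - a) * exp (2 * max 1 Q * (T - a))"
  proof (rule gronwall_nn_integral[where B = "y T + Y0", OF _ _ _ D_le T order.refl])
    show "0 \<le> D s \<and> D s \<le> y T + Y0" if "a \<le> s" "s \<le> T" for s
      using y_bd[of s] Y0[of s] that by (auto simp: D_def)
  qed auto
  then show ?thesis by (simp add: D_def)
qed

text \<open>Keeping the exponent \<open>r\<close> and dividing by \<open>t + 1\<close> matches the
  coefficients \<alpha> / (t + 1) of the moment equations, so that verifying them is rational
  arithmetic.\<close>

lemma has_real_derivative_powr_shift:
  "0 \<le> t \<Longrightarrow> ((\<lambda>t. (t + 1) powr r) has_real_derivative r * (t + 1) powr r / (t + 1)) (at t)"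
  for t :: real
  by (auto intro!: derivative_eq_intros simp: powr_diff)

subsection \<open>Paths of a simple point process\<close>

text \<open>Singletons are differences of consecutive upper level sets. For monotone paths the upper
  level sets are the ones that reduce to rational times.\<close>

lemma measurable_natI:
  fixes f :: "'a \<Rightarrow> nat"
  assumes "\<And>j. {x \<in> space A. j \<le> f x} \<in> sets A"
  shows "f \<in> A \<rightarrow>\<^sub>M count_space UNIV"
proof -
  have "f -` {k} \<inter> space A = {x \<in> space A. k \<le> f x} - {x \<in> space A. Suc k \<le> f x}" for k
    by auto
  then have "f -` {k} \<inter> space A \<in> sets A" for k using assms by (auto intro!: sets.Diff)
  then show ?thesis by (simp add: measurable_count_space_eq2_countable)
qed

locale counting_process = prob_space M
  for M :: "'a measure" +
  fixes N :: "real \<Rightarrow> 'a \<Rightarrow> nat"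
  assumes simple: "simple_point_process M N"
begin

lemma measurable_N [measurable]: "0 \<le> t \<Longrightarrow> N t \<in> M \<rightarrow>\<^sub>M count_space UNIV"
  using simple unfolding simple_point_process_def point_process_def by blast

lemma N_0: "\<omega> \<in> space M \<Longrightarrow> N 0 \<omega> = 0"
  using simple unfolding simple_point_process_def point_process_def by blast

lemma N_mono: "\<omega> \<in> space M \<Longrightarrow> 0 \<le> s \<Longrightarrow> s \<le> t \<Longrightarrow> N s \<omega> \<le> N t \<omega>"
  using simple unfolding simple_point_process_def point_process_def mono_on_def by fastforce

text \<open>The topology of \<open>nat\<close> is discrete, so right continuity means that the path
  is constant for a while to the right.\<close>

lemma N_right_continuous:
  assumes "\<omega> \<in> space M" "0 \<le> t"
  shows "\<forall>\<^sub>F s in at_right t. N s \<omega> = N t \<omega>"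
proof -
  have "continuous (at_right t) (\<lambda>s. N s \<omega>)"
    using simple assms unfolding simple_point_process_def point_process_def by blast
  then show ?thesis
    by (simp add: continuous_within nhds_discrete filterlim_principal)
qed

lemma N_right_constant:
  assumes "\<omega> \<in> space M" "0 \<le> t"
  obtains u where "t < u" "\<And>s. t \<le> s \<Longrightarrow> s < u \<Longrightarrow> N s \<omega> = N t \<omega>"
proof -
  obtain u where "t < u" "\<And>s. t < s \<Longrightarrow> s < u \<Longrightarrow> N s \<omega> = N t \<omega>"
    using N_right_continuous[OF assms] unfolding eventually_at_right_field by blast
  then show thesis by (intro that[of u]) (auto simp: order_le_less)
qed

text \<open>On \<open>{0..<t}\<close> the path takes finitely many values, being bounded by
  \<open>N t \<omega>\<close>; from a time where the largest is reached it stays constant up to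
  \<open>t\<close>. This also shows that the limit behind \<open>Lim\<close> exists.\<close>

lemma left_limit_attained:
  assumes "\<omega> \<in> space M" "0 < t"
  obtains r where "0 \<le> r" "r < t" "\<And>s. r \<le> s \<Longrightarrow> s < t \<Longrightarrow> N s \<omega> = left_limit N t \<omega>"
proof -
  let ?A = "(\<lambda>s. N s \<omega>) ` {0..<t}"
  have "?A \<subseteq> {..N t \<omega>}" using N_mono assms by auto
  then have fin: "finite ?A" using finite_subset by blast
  have "?A \<noteq> {}" using assms by auto
  then have "Max ?A \<in> ?A" using fin Max_in by blast
  then obtain r where r: "0 \<le> r" "r < t" "N r \<omega> = Max ?A" by auto
  have eq: "N s \<omega> = N r \<omega>" if "r \<le> s" "s < t" for s
  proof (rule antisym)
    show "N s \<omega> \<le> N r \<omega>" unfolding r(3) using that r fin by (intro Max_ge) auto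
    show "N r \<omega> \<le> N s \<omega>" using N_mono[OF assms(1) r(1) that(1)] r(3) by simp
  qed
  have "\<forall>\<^sub>F s in at_left t. N s \<omega> = N r \<omega>"
    unfolding eventually_at_left_field using r(2) by (intro exI[of _ r]) (auto intro: eq)
  then have "((\<lambda>s. N s \<omega>) \<longlongrightarrow> N r \<omega>) (at_left t)"
    by (simp add: tendsto_eventually)
  then have "left_limit N t \<omega> = N r \<omega>"
    unfolding left_limit_def by (intro tendsto_Lim) auto
  then show thesis using eq that[OF r(1,2)] by metis
qed

lemma le_left_limit_iff:
  assumes "\<omega> \<in> space M" "0 < t"
  shows "j \<le> left_limit N t \<omega> \<longleftrightarrow> (\<exists>r\<ge>0. r < t \<and> j \<le> N r \<omega>)"
proof -
  obtain r where r: "0 \<le> r" "r < t" "\<And>s. r \<le> s \<Longrightarrow> s < t \<Longrightarrow> N s \<omega> = left_limit N t \<omega>"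
    using left_limit_attained[OF assms] by blast
  have "N s \<omega> \<le> left_limit N t \<omega>" if "0 \<le> s" "s < t" for s
    using N_mono[OF assms(1), of s "max r s"] r(3)[of "max r s"] r that by auto
  then show ?thesis using r by (metis order.refl order.trans)
qed

text \<open>Restricting to rational times makes the condition a countable union, as needed for
  predictability.\<close>

lemma le_left_limit_iff_rat:
  assumes "\<omega> \<in> space M" "0 < t"
  shows "j \<le> left_limit N t \<omega> \<longleftrightarrow> (\<exists>r\<in>\<rat>. 0 \<le> r \<and> r < t \<and> j \<le> N r \<omega>)"
proof
  assume "j \<le> left_limit N t \<omega>"
  then obtain r where r: "0 \<le> r" "r < t" "j \<le> N r \<omega>"
    using le_left_limit_iff[OF assms] by auto
  obtain q where "q \<in> \<rat>" "r < q" "q < t" using Rats_dense_in_real[OF r(2)] by auto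
  then show "\<exists>r\<in>\<rat>. 0 \<le> r \<and> r < t \<and> j \<le> N r \<omega>"
    using r N_mono[OF assms(1), of r q] by (intro bexI[of _ q]) auto
qed (use le_left_limit_iff[OF assms] in blast)

lemma left_limit_le: "\<omega> \<in> space M \<Longrightarrow> 0 < t \<Longrightarrow> left_limit N t \<omega> \<le> N t \<omega>"
  using le_left_limit_iff[of \<omega> t "left_limit N t \<omega>"] N_mono[of \<omega> _ t] by fastforce

text \<open>A monotone path has at most countably many discontinuities. Hence the left limit may be
  replaced by the value under Lebesgue integrals, though not under
  \<open>path_measure\<close>.\<close>

lemma AE_left_limit_eq:
  assumes "\<omega> \<in> space M"
  shows "AE s in lborel. 0 < s \<longrightarrow> left_limit N s \<omega> = N s \<omega>"
proof -
  let ?F = "\<lambda>s. real (N (max 0 s) \<omega>)"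
  have "mono ?F" using N_mono[OF assms] by (auto intro!: monoI)
  then have "countable {s. \<not> isCont ?F s}" by (rule mono_ctble_discont)
  then have "AE s in lborel. s \<notin> {s. \<not> isCont ?F s}"
    by (intro AE_not_in countable_imp_null_set_lborel)
  then show ?thesis
  proof eventually_elim
    case (elim s)
    show ?case
    proof
      assume s: "0 < s"
      from elim have "(?F \<longlongrightarrow> ?F s) (at_left s)"
        by (auto simp: isCont_def intro: filterlim_mono[OF _ order.refl] at_le)
      moreover obtain r where r: "0 \<le> r" "r < s"
          "\<And>u. r \<le> u \<Longrightarrow> u < s \<Longrightarrow> N u \<omega> = left_limit N s \<omega>"
        using left_limit_attained[OF assms s] by blast
      have "\<forall>\<^sub>F u in at_left s. ?F u = real (left_limit N s \<omega>)"
        unfolding eventually_at_left_field using r by (intro exI[of _ r]) (simp add: order.strict_implies_order)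
      then have "(?F \<longlongrightarrow> real (left_limit N s \<omega>)) (at_left s)"
        by (simp add: tendsto_eventually)
      ultimately have "?F s = real (left_limit N s \<omega>)"
        using tendsto_unique trivial_limit_at_left_real by blast
      then show "left_limit N s \<omega> = N s \<omega>" using s by simp
    qed
  qed
qed

section \<open>Integration against the Stieltjes measure of a path\<close>

lemma emeasure_path_measure_Ioc:
  assumes "\<omega> \<in> space M" "0 \<le> a" "a \<le> b"
  shows "emeasure (path_measure N \<omega>) {a<..b} = of_nat (N b \<omega> - N a \<omega>)"
proof -
  let ?F = "\<lambda>s. real (N (max 0 s) \<omega>)"
  \<comment> \<open>The Stieltjes measure requires right continuity at every real point, including
    the negative ones, where the extended path is constant.\<close>
  have "continuous (at_right c) ?F" for c
  proof (cases "c < 0")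
    case True
    then have "\<forall>\<^sub>F s in at_right c. ?F s = ?F c"
      unfolding eventually_at_right_field by (intro exI[of _ 0]) auto
    then show ?thesis by (simp add: continuous_within tendsto_eventually)
  next
    case False
    obtain u where u: "c < u" "\<And>s. c \<le> s \<Longrightarrow> s < u \<Longrightarrow> N s \<omega> = N c \<omega>"
      using N_right_constant[OF assms(1), of c] False by auto
    have "?F s = ?F c" if "c < s" "s < u" for s using u(2)[of s] False that by simp
    then have "\<forall>\<^sub>F s in at_right c. ?F s = ?F c"
      unfolding eventually_at_right_field using u(1) by blast
    then show ?thesis by (simp add: continuous_within tendsto_eventually)
  qed
  then have "emeasure (path_measure N \<omega>) {a<..b} = ennreal (?F b - ?F a)"
    unfolding path_measure_def using assms N_mono[OF assms(1)]
    by (intro emeasure_interval_measure_Ioc) auto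
  also have "\<dots> = of_nat (N b \<omega> - N a \<omega>)"
    using assms N_mono[OF assms(1), of a b] by (simp add: ennreal_of_nat_eq_real_of_nat of_nat_diff)
  finally show ?thesis .
qed

text \<open>\<open>\<tau>\<close> is the first time at which the path reaches level
  \<open>j\<close>, capped at \<open>t\<close>. At that time the left limit is still below
  \<open>j\<close>, so the level set contains its right endpoint; since jumps have size at most one,
  the path cannot skip over \<open>j\<close>.\<close>

lemma left_limit_level_set:
  assumes \<omega>: "\<omega> \<in> space M" and jump: "\<forall>t>0. N t \<omega> \<le> left_limit N t \<omega> + 1" and t: "0 \<le> t"
  obtains \<tau> where "0 \<le> \<tau>" "\<tau> \<le> t" "N \<tau> \<omega> = min j (N t \<omega>)"
    "{s \<in> {0<..t}. left_limit N s \<omega> < j} = {0<..\<tau>}"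
proof (cases "j \<le> N t \<omega>")
  case False
  then have "left_limit N s \<omega> < j" if "s \<in> {0<..t}" for s
    using that left_limit_le[OF \<omega>, of s] N_mono[OF \<omega>, of s t] by auto
  then show thesis using False t by (intro that[of t]) auto
next
  case True
  show thesis
  proof (cases "j = 0")
    case j0: True
    then show thesis using t N_0[OF \<omega>] by (intro that[of 0]) auto
  next
    case False
    let ?A = "{s. 0 \<le> s \<and> j \<le> N s \<omega>}"
    define \<tau> where "\<tau> = Inf ?A"
    have bdd: "bdd_below ?A" by (intro bdd_belowI[of _ 0]) auto
    have tA: "t \<in> ?A" using t True by auto
    have \<tau>0: "0 \<le> \<tau>" unfolding \<tau>_def using tA by (intro cInf_greatest) auto
    have \<tau>t: "\<tau> \<le> t" unfolding \<tau>_def using tA bdd by (intro cInf_lower) auto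
    have below: "N s \<omega> < j" if "0 \<le> s" "s < \<tau>" for s
      using cInf_lower[OF _ bdd, of s] that unfolding \<tau>_def by force
    \<comment> \<open>Right continuity makes the infimum attained: just after \<open>\<tau>\<close>
      there is a time in \<open>?A\<close>, and the path has not changed since
      \<open>\<tau>\<close>.\<close>
    have ge: "j \<le> N \<tau> \<omega>"
    proof -
      obtain u where u: "\<tau> < u" "\<And>s. \<tau> \<le> s \<Longrightarrow> s < u \<Longrightarrow> N s \<omega> = N \<tau> \<omega>"
        using N_right_constant[OF \<omega> \<tau>0] by blast
      obtain s where "s \<in> ?A" "s < u"
        using u(1) cInf_less_iff[of ?A u] tA bdd unfolding \<tau>_def by blast
      moreover from this have "\<tau> \<le> s" unfolding \<tau>_def using bdd by (intro cInf_lower)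
      ultimately show ?thesis using u(2)[of s] by auto
    qed
    have pos: "0 < \<tau>" using ge False N_0[OF \<omega>] \<tau>0 by (cases "\<tau> = 0") auto
    have ll: "left_limit N \<tau> \<omega> < j"
      using le_left_limit_iff[OF \<omega> pos, of j] below by (metis not_le)
    have "N \<tau> \<omega> = j" using ge ll jump pos by (metis Suc_eq_plus1 le_antisym less_eq_Suc_le order.trans Suc_le_mono)
    moreover have "left_limit N s \<omega> < j \<longleftrightarrow> s \<le> \<tau>" if "0 < s" for s
      using le_left_limit_iff[OF \<omega> that, of j] ge below \<tau>0
      by (metis not_le order.strict_trans1 order.trans linorder_le_less_linear)
    ultimately show thesis using \<tau>0 \<tau>t True by (intro that[of \<tau>]) auto
  qed
qed

text \<open>Each level set of the left limit within \<open>{a<..b}\<close> is a half-open interval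
  between successive hitting times. It has mass 1 if the level \<open>j\<close> is left during
  \<open>{a<..b}\<close>, that is if N_a \<le> j < N_b, and mass 0 otherwise; summing over levels
  gives the claim.\<close>

lemma nn_integral_path_measure:
  fixes d :: "nat \<Rightarrow> ennreal"
  assumes \<omega>: "\<omega> \<in> space M" and jump: "\<forall>t>0. N t \<omega> \<le> left_limit N t \<omega> + 1"
    and ab: "0 \<le> a" "a \<le> b"
  shows "(\<integral>\<^sup>+s\<in>{a<..b}. d (left_limit N s \<omega>) \<partial>path_measure N \<omega>) = (\<Sum>j=N a \<omega>..<N b \<omega>. d j)"
proof -
  have b: "0 \<le> b" using ab by simp
  let ?L = "\<lambda>j. {s \<in> {a<..b}. left_limit N s \<omega> = j}"
  have sets: "sets (path_measure N \<omega>) = sets borel" by (simp add: path_measure_def)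
  have L: "?L j \<in> sets borel \<and>
      emeasure (path_measure N \<omega>) (?L j) = (if j \<in> {N a \<omega>..<N b \<omega>} then 1 else 0)" for j
  proof -
    obtain \<sigma> where \<sigma>: "0 \<le> \<sigma>" "\<sigma> \<le> b" "N \<sigma> \<omega> = min j (N b \<omega>)"
        "{s \<in> {0<..b}. left_limit N s \<omega> < j} = {0<..\<sigma>}"
      using left_limit_level_set[OF \<omega> jump b, of j] by blast
    obtain \<tau> where \<tau>: "0 \<le> \<tau>" "\<tau> \<le> b" "N \<tau> \<omega> = min (Suc j) (N b \<omega>)"
        "{s \<in> {0<..b}. left_limit N s \<omega> < Suc j} = {0<..\<tau>}"
      using left_limit_level_set[OF \<omega> jump b, of "Suc j"] by blast
    have "{0<..\<sigma>} \<subseteq> {0<..\<tau>}" unfolding \<sigma>(4)[symmetric] \<tau>(4)[symmetric] by auto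
    then have le: "\<sigma> \<le> \<tau>" using \<sigma>(1) \<tau>(1) by (cases "\<sigma> = 0") (auto simp: subset_iff)
    have lev: "s \<in> {0<..b} \<Longrightarrow> left_limit N s \<omega> = j \<longleftrightarrow> s \<in> {0<..\<tau>} - {0<..\<sigma>}" for s
      unfolding \<sigma>(4)[symmetric] \<tau>(4)[symmetric] by auto
    have eq: "?L j = {max a \<sigma><..max a \<tau>}"
    proof (rule set_eqI)
      fix s
      show "s \<in> ?L j \<longleftrightarrow> s \<in> {max a \<sigma><..max a \<tau>}"
        using lev[of s] ab \<sigma>(1,2) \<tau>(1,2) by (cases "0 < s \<and> s \<le> b") auto
    qed
    \<comment> \<open>The hitting times may precede \<open>a\<close>. Clipping them at
      \<open>a\<close> acts on the path values as \<open>max (N a \<omega>)\<close>, by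
      monotonicity.\<close>
    have mx: "N (max a u) \<omega> = max (N a \<omega>) (N u \<omega>)" if "0 \<le> u" for u
      using N_mono[OF \<omega>, of a u] N_mono[OF \<omega>, of u a] ab that by (auto simp: max_def)
    have "emeasure (path_measure N \<omega>) (?L j) = of_nat (N (max a \<tau>) \<omega> - N (max a \<sigma>) \<omega>)"
      unfolding eq using ab le by (intro emeasure_path_measure_Ioc[OF \<omega>]) auto
    also have "N (max a \<tau>) \<omega> - N (max a \<sigma>) \<omega> = (if j \<in> {N a \<omega>..<N b \<omega>} then 1 else 0)"
      using N_mono[OF \<omega> ab] by (auto simp: mx \<sigma> \<tau>)
    finally show ?thesis using eq by simp
  qed
  \<comment> \<open>Up to time \<open>b\<close> the left limit does not exceed
    \<open>N b \<omega>\<close>, so finitely many level sets cover the interval.\<close>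
  have "(\<integral>\<^sup>+s\<in>{a<..b}. d (left_limit N s \<omega>) \<partial>path_measure N \<omega>) =
      (\<integral>\<^sup>+s. (\<Sum>j\<le>N b \<omega>. d j * indicator (?L j) s) \<partial>path_measure N \<omega>)"
  proof (intro nn_integral_cong)
    fix s
    show "d (left_limit N s \<omega>) * indicator {a<..b} s = (\<Sum>j\<le>N b \<omega>. d j * indicator (?L j) s)"
    proof (cases "s \<in> {a<..b}")
      case True
      then have "left_limit N s \<omega> \<le> N b \<omega>"
        using left_limit_le[OF \<omega>, of s] N_mono[OF \<omega>, of s b] ab by auto
      moreover have "(\<Sum>j\<le>N b \<omega>. d j * indicator (?L j) s) =
          (\<Sum>j\<le>N b \<omega>. if left_limit N s \<omega> = j then d j else 0)"
        using True by (intro sum.cong) (auto simp: indicator_def)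
      ultimately show ?thesis using True by simp
    qed (auto simp: indicator_def)
  qed
  also have "\<dots> = (\<Sum>j\<le>N b \<omega>. d j * (if j \<in> {N a \<omega>..<N b \<omega>} then 1 else 0))"
  proof -
    have "?L j \<in> sets (path_measure N \<omega>)" for j using L sets by simp
    then show ?thesis using L
      by (subst nn_integral_sum) (auto intro!: sum.cong simp: nn_integral_cmult_indicator)
  qed
  also have "\<dots> = (\<Sum>j=N a \<omega>..<N b \<omega>. d j)"
    by (intro sum.mono_neutral_cong_right) auto
  finally show ?thesis .
qed

subsection \<open>Predictable integrands\<close>

lemma vimage_natural_filtration:
  assumes "0 \<le> s" "s \<le> t"
  shows "{\<omega> \<in> space M. N s \<omega> \<in> B} \<in> sets (natural_filtration M N t)"
proof -
  have "N s -` B \<inter> space M \<in> {N s -` B \<inter> space M | s B. 0 \<le> s \<and> s \<le> t}" using assms by blast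
  then show ?thesis unfolding natural_filtration_def
    by (subst sets_measure_of) (auto simp: vimage_def Int_def conj_commute)
qed

lemma space_predictable [simp]:
  "space (predictable_sigma M (natural_filtration M N)) = {0<..} \<times> space M"
  unfolding predictable_sigma_def by (simp add: space_measure_of_conv)

lemma Ioc_times_predictable:
  assumes "0 \<le> a" "A \<in> sets (natural_filtration M N a)"
  shows "{a<..b} \<times> A \<in> sets (predictable_sigma M (natural_filtration M N))"
proof (cases "a \<le> b")
  case True
  have sub: "A \<subseteq> space M" if "A \<in> sets (natural_filtration M N a)" for A a
    using sets.sets_into_space[OF that] unfolding natural_filtration_def by (simp add: space_measure_of_conv)
  have "{{a<..b} \<times> A | a b A. 0 \<le> a \<and> a \<le> b \<and> A \<in> sets (natural_filtration M N a)}
      \<subseteq> Pow ({0<..} \<times> space M)"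
    using sub by fastforce
  then show ?thesis unfolding predictable_sigma_def using assms True
    by (subst sets_measure_of) auto
qed auto

lemma measurable_left_limit_predictable [measurable]:
  "(\<lambda>p. left_limit N (fst p) (snd p)) \<in>
     predictable_sigma M (natural_filtration M N) \<rightarrow>\<^sub>M count_space UNIV"
proof (rule measurable_natI)
  fix j
  let ?P = "predictable_sigma M (natural_filtration M N)"
  have "{p \<in> space ?P. j \<le> left_limit N (fst p) (snd p)} =
      (\<Union>r\<in>\<rat> \<inter> {0..}. \<Union>n::nat. {r<..real n} \<times> {\<omega> \<in> space M. N r \<omega> \<in> {j..}})"
    using real_arch_simple by (fastforce simp: le_left_limit_iff_rat)
  also have "\<dots> \<in> sets ?P"
    by (intro sets.countable_UN' sets.countable_UN countable_Int1 countable_rat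
        image_subsetI Ioc_times_predictable vimage_natural_filtration) auto
  finally show "{p \<in> space ?P. j \<le> left_limit N (fst p) (snd p)} \<in> sets ?P" .
qed

lemma measurable_indicator_N_predictable:
  assumes "0 \<le> a"
  shows "(\<lambda>p. indicator {a<..b} (fst p) * h (N a (snd p)) :: ennreal) \<in>
     borel_measurable (predictable_sigma M (natural_filtration M N))"
proof -
  let ?P = "predictable_sigma M (natural_filtration M N)"
  \<comment> \<open>A single natural number encodes both factors: 0 off the strip and
    \<open>Suc (N a (snd p))\<close> on it. The value at time \<open>a\<close> is predictable only
    after \<open>a\<close>, and an arbitrary \<open>h\<close> may then be composed with the discrete
    map.\<close>
  let ?f = "\<lambda>p. if fst p \<in> {a<..b} then Suc (N a (snd p)) else 0"
  have "?f \<in> ?P \<rightarrow>\<^sub>M count_space UNIV"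
  proof (rule measurable_natI)
    fix j
    have "{p \<in> space ?P. j \<le> ?f p} =
        (if j = 0 then space ?P else {a<..b} \<times> {\<omega> \<in> space M. N a \<omega> \<in> {j - 1..}})"
      using assms by (auto split: if_splits)
    also have "\<dots> \<in> sets ?P"
      using Ioc_times_predictable[OF assms vimage_natural_filtration[OF assms order.refl, of "{j - 1..}"]]
      by (auto simp del: space_predictable)
    finally show "{p \<in> space ?P. j \<le> ?f p} \<in> sets ?P" .
  qed
  then have "(\<lambda>p. case ?f p of 0 \<Rightarrow> 0 | Suc n \<Rightarrow> h n) \<in> borel_measurable ?P"
    by (rule measurable_compose) simp
  then show ?thesis by (rule measurable_cong[THEN iffD1, rotated]) auto
qed

text \<open>Joint measurability, needed for Fubini. By right continuity and monotonicity, N_s < j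
  holds iff N_q < j for some rational q > s.\<close>

lemma measurable_N_pair [measurable]:
  "(\<lambda>p. N (max 0 (fst p)) (snd p)) \<in> (lborel \<Otimes>\<^sub>M M) \<rightarrow>\<^sub>M count_space UNIV"
proof (rule measurable_natI)
  fix j
  let ?P = "lborel \<Otimes>\<^sub>M M :: (real \<times> 'a) measure"
  have "N (max 0 s) \<omega> < j \<longleftrightarrow> (\<exists>q\<in>\<rat> \<inter> {0..}. s < q \<and> N q \<omega> < j)" if \<omega>: "\<omega> \<in> space M" for s \<omega>
  proof
    assume less: "N (max 0 s) \<omega> < j"
    obtain u where u: "max 0 s < u"
        "\<And>r. max 0 s \<le> r \<Longrightarrow> r < u \<Longrightarrow> N r \<omega> = N (max 0 s) \<omega>"
      using N_right_constant[OF \<omega>, of "max 0 s"] by auto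
    obtain q where q: "q \<in> \<rat>" "max 0 s < q" "q < u" using Rats_dense_in_real[OF u(1)] by auto
    have "N q \<omega> < j" using u(2)[of q] q less by simp
    with q have "q \<in> \<rat> \<inter> {0..}" "s < q" "N q \<omega> < j" by auto
    then show "\<exists>q\<in>\<rat> \<inter> {0..}. s < q \<and> N q \<omega> < j" by blast
  next
    assume "\<exists>q\<in>\<rat> \<inter> {0..}. s < q \<and> N q \<omega> < j"
    then obtain q where "0 \<le> q" "s < q" "N q \<omega> < j" by auto
    then show "N (max 0 s) \<omega> < j" using N_mono[OF \<omega>, of "max 0 s" q] by auto
  qed
  then have "{p \<in> space ?P. j \<le> N (max 0 (fst p)) (snd p)} =
      space ?P - (\<Union>q\<in>\<rat> \<inter> {0..}. {..<q} \<times> {\<omega> \<in> space M. N q \<omega> < j})"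
    by (auto simp: space_pair_measure not_less[symmetric])
  also have "\<dots> \<in> sets ?P"
    by (intro sets.Diff sets.top sets.countable_UN' countable_Int1 countable_rat pair_measureI) auto
  finally show "{p \<in> space ?P. j \<le> N (max 0 (fst p)) (snd p)} \<in> sets ?P" .
qed

end

subsection \<open>Moments\<close>

text \<open>The increments 2j + 1 of consecutive squares, switched off from level \<open>K\<close>
  on, add up to a bounded square.\<close>

lemma truncated_square_sum: "(\<Sum>j<n. if j < K then 2 * j + 1 else 0) = (min n K)\<^sup>2" for n K :: nat
proof (induction n)
  case (Suc n)
  then show ?case
    by (cases "n < K") (simp_all add: min_absorb1 min_absorb2 power2_eq_square)
qed simp

locale self_exciting = counting_process M N
  for M :: "'a measure" and N :: "real \<Rightarrow> 'a \<Rightarrow> nat" +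
  fixes \<alpha> \<beta> :: real
  assumes \<alpha>_pos: "0 < \<alpha>" and \<beta>_pos: "0 < \<beta>"
    and intensity: "has_intensity M (natural_filtration M N) N
           (\<lambda>t \<omega>. \<beta> + \<alpha> * (real (left_limit N t \<omega>) / (t + 1)))"
begin

definition rate :: "real \<Rightarrow> nat \<Rightarrow> real" where
  "rate s n = \<beta> + \<alpha> * (real n / (s + 1))"

lemma rate_nonneg: "0 \<le> s \<Longrightarrow> 0 \<le> rate s n"
  using \<alpha>_pos \<beta>_pos by (simp add: rate_def)

lemma rate_le: "0 \<le> s \<Longrightarrow> rate s n \<le> \<beta> + \<alpha> * real n"
  using \<alpha>_pos by (simp add: rate_def divide_le_eq mult_left_le_one_le field_simps)

text \<open>On the jump side the inner integral is computed path by path; on the Lebesgue side the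
  left limit is replaced by the value and the integrals are exchanged. Working in
  \<open>ennreal\<close> makes the identity available before any moment is known to be
  finite.\<close>

lemma intensity_formula:
  fixes h d :: "nat \<Rightarrow> ennreal"
  assumes ab: "0 \<le> a" "a \<le> b"
  shows "(\<integral>\<^sup>+\<omega>. h (N a \<omega>) * (\<Sum>j=N a \<omega>..<N b \<omega>. d j) \<partial>M) =
    (\<integral>\<^sup>+s\<in>{a<..b}. (\<integral>\<^sup>+\<omega>. h (N a \<omega>) * (d (N s \<omega>) * ennreal (rate s (N s \<omega>))) \<partial>M) \<partial>lborel)"
proof -
  define C where "C p = indicator {a<..b} (fst p) * h (N a (snd p)) * d (left_limit N (fst p) (snd p))"
    for p
  \<comment> \<open>The Lebesgue integrand with the value in place of the left limit; this version
    is measurable for the product with \<open>M\<close>.\<close>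
  define G where "G p = indicator {a<..b} (fst p) * (h (N a (snd p)) *
    (d (N (max 0 (fst p)) (snd p)) * ennreal (rate (fst p) (N (max 0 (fst p)) (snd p)))))" for p
  have "C \<in> borel_measurable (predictable_sigma M (natural_filtration M N))"
    unfolding C_def using measurable_indicator_N_predictable[OF ab(1)] by measurable
  then have C: "(\<integral>\<^sup>+\<omega>. (\<integral>\<^sup>+s\<in>{0<..}. C (s, \<omega>) \<partial>path_measure N \<omega>) \<partial>M) =
        (\<integral>\<^sup>+\<omega>. (\<integral>\<^sup>+s\<in>{0<..}. C (s, \<omega>) * ennreal (rate s (left_limit N s \<omega>)) \<partial>lborel) \<partial>M)"
    using intensity unfolding has_intensity_def rate_def by blast
  have jump: "AE \<omega> in M. \<forall>t>0. N t \<omega> \<le> left_limit N t \<omega> + 1"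
    using simple unfolding simple_point_process_def by blast
  have "(\<integral>\<^sup>+\<omega>. (\<integral>\<^sup>+s\<in>{0<..}. C (s, \<omega>) \<partial>path_measure N \<omega>) \<partial>M) =
      (\<integral>\<^sup>+\<omega>. h (N a \<omega>) * (\<Sum>j=N a \<omega>..<N b \<omega>. d j) \<partial>M)"
  proof (intro nn_integral_cong_AE, use jump AE_space in eventually_elim)
    case (elim \<omega>)
    have "(\<integral>\<^sup>+s\<in>{0<..}. C (s, \<omega>) \<partial>path_measure N \<omega>) =
        (\<integral>\<^sup>+s\<in>{a<..b}. h (N a \<omega>) * d (left_limit N s \<omega>) \<partial>path_measure N \<omega>)"
      using ab by (intro nn_integral_cong) (auto simp: C_def indicator_def)
    also have "\<dots> = h (N a \<omega>) * (\<Sum>j=N a \<omega>..<N b \<omega>. d j)"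
      using nn_integral_path_measure[OF elim(2,1) ab, of "\<lambda>j. h (N a \<omega>) * d j"]
      by (simp add: sum_distrib_left)
    finally show ?case .
  qed
  moreover have "(\<integral>\<^sup>+\<omega>. (\<integral>\<^sup>+s\<in>{0<..}. C (s, \<omega>) * ennreal (rate s (left_limit N s \<omega>)) \<partial>lborel) \<partial>M) =
      (\<integral>\<^sup>+\<omega>. (\<integral>\<^sup>+s. G (s, \<omega>) \<partial>lborel) \<partial>M)"
  proof (rule nn_integral_cong, rule nn_integral_cong_AE)
    fix \<omega> assume "\<omega> \<in> space M"
    from AE_left_limit_eq[OF this]
    show "AE s in lborel. C (s, \<omega>) * ennreal (rate s (left_limit N s \<omega>)) * indicator {0<..} s = G (s, \<omega>)"
      by eventually_elim (use ab in \<open>auto simp: C_def G_def indicator_def mult.assoc\<close>)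
  qed
  moreover have "\<dots> = (\<integral>\<^sup>+s. (\<integral>\<^sup>+\<omega>. G (s, \<omega>) \<partial>M) \<partial>lborel)"
  proof -
    interpret pair_sigma_finite lborel M ..
    have [measurable]: "(\<lambda>p. N a (snd p)) \<in> (lborel \<Otimes>\<^sub>M M) \<rightarrow>\<^sub>M count_space UNIV"
      using ab by measurable
    have "G \<in> borel_measurable (lborel \<Otimes>\<^sub>M M)"
      unfolding G_def rate_def by measurable
    then show ?thesis by (rule Fubini)
  qed
  moreover have "\<dots> = (\<integral>\<^sup>+s\<in>{a<..b}. (\<integral>\<^sup>+\<omega>. h (N a \<omega>) *
      (d (N s \<omega>) * ennreal (rate s (N s \<omega>))) \<partial>M) \<partial>lborel)"
    using ab by (intro nn_integral_cong) (auto simp: G_def indicator_def max_def)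
  ultimately show ?thesis using C by simp
qed

text \<open>Truncation at \<open>K\<close> supplies the a priori boundedness that Gronwall's
  inequality needs, while the resulting bound does not depend on \<open>K\<close>.\<close>

lemma truncated_square_bound:
  assumes "0 \<le> t"
  shows "(\<integral>\<omega>. (real (min (N t \<omega>) K))\<^sup>2 \<partial>M) \<le>
    2 * \<beta> * t * exp (2 * (2 * \<beta> + 3 * \<alpha>) * t)"
proof -
  define g where "g s = (\<integral>\<omega>. (real (min (N s \<omega>) K))\<^sup>2 \<partial>M)" for s
  have int: "integrable M (\<lambda>\<omega>. (real (min (N s \<omega>) K))\<^sup>2)" if "0 \<le> s" for s
    using that by (intro integrable_const_bound[where B = "(real K)\<^sup>2"]) (auto intro!: power_mono)
  have "g t \<le> 2 * \<beta> * (t - 0) * exp (2 * (2 * \<beta> + 3 * \<alpha>) * (t - 0))"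
  proof (rule gronwall_nn_integral[where B = "(real K)\<^sup>2", OF _ _ _ _ assms order.refl])
    fix s :: real assume s: "0 \<le> s"
    have "g s \<le> (\<integral>\<omega>. (real K)\<^sup>2 \<partial>M)"
      unfolding g_def using s by (intro integral_mono int) (auto intro!: power_mono)
    then show "0 \<le> g s \<and> g s \<le> (real K)\<^sup>2"
      by (simp add: g_def prob_space)
  next
    fix u :: real assume u: "0 \<le> u"
    define d :: "nat \<Rightarrow> ennreal" where "d j = of_nat (if j < K then 2 * j + 1 else 0)" for j
    have sum_d: "(\<Sum>j=N 0 \<omega>..<N u \<omega>. d j) = ennreal ((real (min (N u \<omega>) K))\<^sup>2)" if "\<omega> \<in> space M" for \<omega>
    proof -
      have "(\<Sum>j=N 0 \<omega>..<N u \<omega>. d j) = of_nat ((min (N u \<omega>) K)\<^sup>2)"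
        unfolding truncated_square_sum[symmetric] d_def using N_0[OF that]
        by (simp add: atLeast0LessThan)
      then show ?thesis by (simp only: ennreal_of_nat_eq_real_of_nat of_nat_power)
    qed
    \<comment> \<open>Below \<open>K\<close>, (2n + 1)(\<beta> + \<alpha> n) = \<beta> + (2 \<beta>
      + \<alpha>) n + 2 \<alpha> n^2, and n \<le> n^2 gives the constant 2 \<beta> + 3 \<alpha>.
      From \<open>K\<close> on the left-hand side is 0.\<close>
    have d_le: "d n * ennreal (rate s n) \<le> ennreal (\<beta> + (2 * \<beta> + 3 * \<alpha>) * (real (min n K))\<^sup>2)"
      if s: "0 \<le> s" for s n
    proof (cases "n < K")
      case True
      have "real n \<le> (real n)\<^sup>2"
        by (cases n) (auto simp: power2_eq_square)
      then have "(2 * real n + 1) * (\<beta> + \<alpha> * real n) \<le> \<beta> + (2 * \<beta> + 3 * \<alpha>) * (real n)\<^sup>2"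
        using mult_left_mono[of "real n" "(real n)\<^sup>2" "2 * \<beta> + \<alpha>"] \<alpha>_pos \<beta>_pos
        by (simp add: algebra_simps power2_eq_square)
      then have "(2 * real n + 1) * rate s n \<le> \<beta> + (2 * \<beta> + 3 * \<alpha>) * (real n)\<^sup>2"
        using mult_left_mono[OF rate_le[OF s, of n], of "2 * real n + 1"] by linarith
      moreover have "d n * ennreal (rate s n) = ennreal ((2 * real n + 1) * rate s n)"
      proof -
        have "d n = of_nat (2 * n + 1)" using True by (simp add: d_def)
        then have "d n * ennreal (rate s n) = ennreal (real (2 * n + 1) * rate s n)"
          by (simp only: ennreal_of_nat_eq_real_of_nat ennreal_mult' of_nat_0_le_iff)
        then show ?thesis by (simp add: add.commute)
      qed
      ultimately show ?thesis using True by (auto intro: ennreal_leI)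
    qed (simp add: d_def)
    have "ennreal (g u) = (\<integral>\<^sup>+\<omega>. ennreal ((real (min (N u \<omega>) K))\<^sup>2) \<partial>M)"
      unfolding g_def using int[OF u] by (subst nn_integral_eq_integral) auto
    also have "\<dots> = (\<integral>\<^sup>+\<omega>. 1 * (\<Sum>j=N 0 \<omega>..<N u \<omega>. d j) \<partial>M)"
      by (intro nn_integral_cong) (simp add: sum_d)
    also have "\<dots> = (\<integral>\<^sup>+s\<in>{0<..u}. (\<integral>\<^sup>+\<omega>. 1 * (d (N s \<omega>) * ennreal (rate s (N s \<omega>))) \<partial>M) \<partial>lborel)"
      using intensity_formula[of 0 u "\<lambda>_. 1" d] u by simp
    also have "\<dots> \<le> (\<integral>\<^sup>+s\<in>{0<..u}. ennreal (\<beta> + (2 * \<beta> + 3 * \<alpha>) * g s) \<partial>lborel)"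
    proof (rule nn_integral_mono_on)
      fix s assume "s \<in> {0<..u}"
      then have s: "0 \<le> s" by simp
      have "(\<integral>\<^sup>+\<omega>. 1 * (d (N s \<omega>) * ennreal (rate s (N s \<omega>))) \<partial>M) \<le>
          (\<integral>\<^sup>+\<omega>. ennreal (\<beta> + (2 * \<beta> + 3 * \<alpha>) * (real (min (N s \<omega>) K))\<^sup>2) \<partial>M)"
        using d_le[OF s] by (intro nn_integral_mono) simp
      also have "\<dots> = ennreal (\<integral>\<omega>. \<beta> + (2 * \<beta> + 3 * \<alpha>) * (real (min (N s \<omega>) K))\<^sup>2 \<partial>M)"
        using int[OF s] \<alpha>_pos \<beta>_pos by (intro nn_integral_eq_integral) auto
      also have "(\<integral>\<omega>. \<beta> + (2 * \<beta> + 3 * \<alpha>) * (real (min (N s \<omega>) K))\<^sup>2 \<partial>M) =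
          \<beta> + (2 * \<beta> + 3 * \<alpha>) * g s"
        using int[OF s] by (simp add: g_def prob_space)
      finally show "(\<integral>\<^sup>+\<omega>. 1 * (d (N s \<omega>) * ennreal (rate s (N s \<omega>))) \<partial>M) \<le>
        ennreal (\<beta> + (2 * \<beta> + 3 * \<alpha>) * g s)" .
    qed
    finally show "ennreal (g u) \<le> (\<integral>\<^sup>+s\<in>{0<..u}. ennreal (\<beta> + (2 * \<beta> + 3 * \<alpha>) * g s) \<partial>lborel)" .
  qed (use \<alpha>_pos \<beta>_pos in auto)
  then show ?thesis by (simp add: g_def)
qed

text \<open>Monotone convergence as the truncation level grows, under the bound uniform in
  \<open>K\<close>.\<close>

lemma integrable_N_square:
  assumes "0 \<le> t"
  shows "integrable M (\<lambda>\<omega>. (real (N t \<omega>))\<^sup>2)"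
proof (rule integrableI_nonneg)
  show meas: "(\<lambda>\<omega>. (real (N t \<omega>))\<^sup>2) \<in> borel_measurable M"
    using assms by measurable
  let ?f = "\<lambda>K \<omega>. ennreal ((real (min (N t \<omega>) K))\<^sup>2)"
  have "(\<integral>\<^sup>+\<omega>. ennreal ((real (N t \<omega>))\<^sup>2) \<partial>M) \<le> (\<integral>\<^sup>+\<omega>. (SUP K. ?f K \<omega>) \<partial>M)"
    by (intro nn_integral_mono SUP_upper2[of "N t _"]) auto
  also have "\<dots> = (SUP K. \<integral>\<^sup>+\<omega>. ?f K \<omega> \<partial>M)"
    using assms by (intro nn_integral_monotone_convergence_SUP)
      (auto intro!: incseq_SucI le_funI ennreal_leI power_mono)
  also have "\<dots> \<le> ennreal (2 * \<beta> * t * exp (2 * (2 * \<beta> + 3 * \<alpha>) * t))"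
  proof (rule SUP_least)
    fix K
    have "integrable M (\<lambda>\<omega>. (real (min (N t \<omega>) K))\<^sup>2)"
      using assms by (intro integrable_const_bound[where B = "(real K)\<^sup>2"]) (auto intro!: power_mono)
    then have "(\<integral>\<^sup>+\<omega>. ?f K \<omega> \<partial>M) = ennreal (\<integral>\<omega>. (real (min (N t \<omega>) K))\<^sup>2 \<partial>M)"
      by (intro nn_integral_eq_integral) auto
    also have "\<dots> \<le> ennreal (2 * \<beta> * t * exp (2 * (2 * \<beta> + 3 * \<alpha>) * t))"
      by (intro ennreal_leI truncated_square_bound assms)
    finally show "(\<integral>\<^sup>+\<omega>. ?f K \<omega> \<partial>M) \<le> ennreal (2 * \<beta> * t * exp (2 * (2 * \<beta> + 3 * \<alpha>) * t))" .
  qed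
  also have "\<dots> < \<infinity>" by simp
  finally show "(\<integral>\<^sup>+\<omega>. ennreal ((real (N t \<omega>))\<^sup>2) \<partial>M) < \<infinity>" .
qed simp

lemma integrable_N: "0 \<le> t \<Longrightarrow> integrable M (\<lambda>\<omega>. real (N t \<omega>))"
  by (rule square_integrable_imp_integrable) (use integrable_N_square in auto)

lemma integrable_N_mult:
  assumes "0 \<le> s" "s \<le> t"
  shows "integrable M (\<lambda>\<omega>. real (N s \<omega>) * real (N t \<omega>))"
  by (rule Bochner_Integration.integrable_bound[OF integrable_N_square[of t]])
    (use assms N_mono[of _ s t] in \<open>auto simp: power2_eq_square intro!: AE_I2 mult_right_mono\<close>)

definition "mean t = (\<integral>\<omega>. real (N t \<omega>) \<partial>M)"
definition "second_moment t = (\<integral>\<omega>. (real (N t \<omega>))\<^sup>2 \<partial>M)"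
definition "mixed_moment s t = (\<integral>\<omega>. real (N s \<omega>) * real (N t \<omega>) \<partial>M)"

lemma moment_nonneg: "0 \<le> mean t" "0 \<le> second_moment t" "0 \<le> mixed_moment s t"
  unfolding mean_def second_moment_def mixed_moment_def by auto

lemma mean_0: "mean 0 = 0" and second_moment_0: "second_moment 0 = 0"
  by (simp_all add: mean_def second_moment_def N_0 cong: Bochner_Integration.integral_cong)

lemma mixed_moment_self: "mixed_moment s s = second_moment s"
  unfolding second_moment_def mixed_moment_def by (simp add: power2_eq_square)

lemma mean_mono: "mono_on {0..} mean"
  unfolding mean_def by (intro mono_onI integral_mono integrable_N) (auto intro: N_mono)

lemma second_moment_mono: "mono_on {0..} second_moment"
  unfolding second_moment_def
  by (intro mono_onI integral_mono integrable_N_square) (auto intro!: power_mono N_mono)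

lemma mixed_moment_mono: "0 \<le> s \<Longrightarrow> mono_on {s..} (mixed_moment s)"
  unfolding mixed_moment_def
  by (intro mono_onI integral_mono integrable_N_mult) (auto intro!: mult_left_mono N_mono)

section \<open>Integral equations for the first, second and mixed moments\<close>

lemma mean_integral_equation:
  assumes "0 \<le> t"
  shows "ennreal (mean t) = (\<integral>\<^sup>+s\<in>{0<..t}. ennreal (\<beta> + \<alpha> / (s + 1) * mean s) \<partial>lborel)"
proof -
  have "ennreal (mean t) = (\<integral>\<^sup>+\<omega>. ennreal (real (N t \<omega>)) \<partial>M)"
    unfolding mean_def using integrable_N[OF assms] by (subst nn_integral_eq_integral) auto
  also have "\<dots> = (\<integral>\<^sup>+\<omega>. 1 * (\<Sum>j=N 0 \<omega>..<N t \<omega>. 1) \<partial>M)"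
    by (intro nn_integral_cong) (simp add: N_0 ennreal_of_nat_eq_real_of_nat)
  also have "\<dots> = (\<integral>\<^sup>+s\<in>{0<..t}. (\<integral>\<^sup>+\<omega>. 1 * (1 * ennreal (rate s (N s \<omega>))) \<partial>M) \<partial>lborel)"
    using intensity_formula[of 0 t "\<lambda>_. 1" "\<lambda>_. 1"] assms by simp
  also have "\<dots> = (\<integral>\<^sup>+s\<in>{0<..t}. ennreal (\<beta> + \<alpha> / (s + 1) * mean s) \<partial>lborel)"
  proof (rule nn_integral_cong_on)
    fix s assume "s \<in> {0<..t}"
    then have s: "0 \<le> s" by simp
    have r: "rate s n = \<beta> + \<alpha> / (s + 1) * real n" for n by (simp add: rate_def)
    have "(\<integral>\<^sup>+\<omega>. 1 * (1 * ennreal (rate s (N s \<omega>))) \<partial>M) = ennreal (\<integral>\<omega>. rate s (N s \<omega>) \<partial>M)"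
      using integrable_N[OF s] rate_nonneg[OF s] unfolding r mult_1
      by (intro nn_integral_eq_integral) auto
    also have "(\<integral>\<omega>. rate s (N s \<omega>) \<partial>M) = \<beta> + \<alpha> / (s + 1) * mean s"
      unfolding mean_def r using integrable_N[OF s] by (simp add: prob_space)
    finally show "(\<integral>\<^sup>+\<omega>. 1 * (1 * ennreal (rate s (N s \<omega>))) \<partial>M) =
      ennreal (\<beta> + \<alpha> / (s + 1) * mean s)" .
  qed
  finally show ?thesis .
qed

text \<open>The integrand is the expectation of (2n + 1)(\<beta> + \<alpha> n / (s + 1)) at n = N_s,
  expanded in powers of n; finiteness of second moments allows termwise integration.\<close>

lemma second_moment_integral_equation:
  assumes "0 \<le> t"
  shows "ennreal (second_moment t) = (\<integral>\<^sup>+s\<in>{0<..t}.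
    ennreal (\<beta> + (2 * \<beta> + \<alpha> / (s + 1)) * mean s + 2 * \<alpha> / (s + 1) * second_moment s) \<partial>lborel)"
proof -
  define d :: "nat \<Rightarrow> ennreal" where "d j = of_nat (2 * j + 1)" for j
  have odd_sum: "(\<Sum>j<n. 2 * j + 1) = n\<^sup>2" for n :: nat
    by (induction n) (auto simp: power2_eq_square)
  have sum_d: "(\<Sum>j=N 0 \<omega>..<N t \<omega>. d j) = ennreal ((real (N t \<omega>))\<^sup>2)" if "\<omega> \<in> space M" for \<omega>
  proof -
    have "(\<Sum>j=N 0 \<omega>..<N t \<omega>. d j) = of_nat ((N t \<omega>)\<^sup>2)"
      unfolding odd_sum[symmetric] d_def using N_0[OF that] by (simp add: atLeast0LessThan)
    then show ?thesis by (simp only: ennreal_of_nat_eq_real_of_nat of_nat_power)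
  qed
  have "ennreal (second_moment t) = (\<integral>\<^sup>+\<omega>. ennreal ((real (N t \<omega>))\<^sup>2) \<partial>M)"
    unfolding second_moment_def using integrable_N_square[OF assms]
    by (subst nn_integral_eq_integral) auto
  also have "\<dots> = (\<integral>\<^sup>+\<omega>. 1 * (\<Sum>j=N 0 \<omega>..<N t \<omega>. d j) \<partial>M)"
    by (intro nn_integral_cong) (simp add: sum_d)
  also have "\<dots> = (\<integral>\<^sup>+s\<in>{0<..t}. (\<integral>\<^sup>+\<omega>. 1 * (d (N s \<omega>) * ennreal (rate s (N s \<omega>))) \<partial>M) \<partial>lborel)"
    using intensity_formula[of 0 t "\<lambda>_. 1" d] assms by simp
  also have "\<dots> = (\<integral>\<^sup>+s\<in>{0<..t}.
      ennreal (\<beta> + (2 * \<beta> + \<alpha> / (s + 1)) * mean s + 2 * \<alpha> / (s + 1) * second_moment s) \<partial>lborel)"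
  proof (rule nn_integral_cong_on)
    fix s assume "s \<in> {0<..t}"
    then have s: "0 \<le> s" by simp
    let ?r = "\<lambda>n. \<beta> + (2 * \<beta> + \<alpha> / (s + 1)) * real n + 2 * \<alpha> / (s + 1) * (real n)\<^sup>2"
    have r: "1 * (d n * ennreal (rate s n)) = ennreal (?r n)" for n
    proof -
      have "d n * ennreal (rate s n) = ennreal (real (2 * n + 1) * rate s n)"
        unfolding d_def by (simp only: ennreal_of_nat_eq_real_of_nat ennreal_mult' of_nat_0_le_iff)
      also have "real (2 * n + 1) * rate s n = ?r n"
        by (simp add: rate_def algebra_simps add_divide_distrib power2_eq_square)
      finally show ?thesis by simp
    qed
    have "(\<integral>\<^sup>+\<omega>. ennreal (?r (N s \<omega>)) \<partial>M) = ennreal (\<integral>\<omega>. ?r (N s \<omega>) \<partial>M)"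
      using integrable_N[OF s] integrable_N_square[OF s] s \<alpha>_pos \<beta>_pos
      by (intro nn_integral_eq_integral) auto
    also have "(\<integral>\<omega>. ?r (N s \<omega>) \<partial>M) =
        \<beta> + (2 * \<beta> + \<alpha> / (s + 1)) * mean s + 2 * \<alpha> / (s + 1) * second_moment s"
      unfolding mean_def second_moment_def using integrable_N[OF s] integrable_N_square[OF s]
      by (simp add: prob_space)
    finally show "(\<integral>\<^sup>+\<omega>. 1 * (d (N s \<omega>) * ennreal (rate s (N s \<omega>))) \<partial>M) =
        ennreal (\<beta> + (2 * \<beta> + \<alpha> / (s + 1)) * mean s + 2 * \<alpha> / (s + 1) * second_moment s)"
      unfolding r .
  qed
  finally show ?thesis .
qed

text \<open>Split N_s N_t as N_s^2 + N_s (N_t - N_s); the intensity formula on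
  \<open>{s<..t}\<close> applies to the second summand.\<close>

lemma mixed_moment_integral_equation:
  assumes "0 \<le> s" "s \<le> t"
  shows "ennreal (mixed_moment s t) = ennreal (second_moment s) +
    (\<integral>\<^sup>+u\<in>{s<..t}. ennreal (\<beta> * mean s + \<alpha> / (u + 1) * mixed_moment s u) \<partial>lborel)"
proof -
  have nn: "(\<integral>\<^sup>+\<omega>. ennreal (real (N s \<omega>) * real (N u \<omega>)) \<partial>M) = ennreal (mixed_moment s u)"
    if "s \<le> u" for u
    unfolding mixed_moment_def using integrable_N_mult[OF assms(1) that]
    by (subst nn_integral_eq_integral) auto
  have "ennreal (mixed_moment s t) = (\<integral>\<^sup>+\<omega>. ennreal (real (N s \<omega>) * real (N t \<omega>)) \<partial>M)"
    using nn[OF assms(2)] by simp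
  also have "\<dots> = (\<integral>\<^sup>+\<omega>. ennreal (real (N s \<omega>) * real (N s \<omega>)) +
      of_nat (N s \<omega>) * (\<Sum>j=N s \<omega>..<N t \<omega>. 1) \<partial>M)"
  proof (intro nn_integral_cong)
    fix \<omega> assume "\<omega> \<in> space M"
    then have "N t \<omega> = N s \<omega> + (N t \<omega> - N s \<omega>)" using N_mono[of \<omega> s t] assms by simp
    then have "real (N s \<omega>) * real (N t \<omega>) =
        real (N s \<omega>) * real (N s \<omega>) + real (N s \<omega>) * real (N t \<omega> - N s \<omega>)"
      by (metis distrib_left of_nat_add)
    then show "ennreal (real (N s \<omega>) * real (N t \<omega>)) = ennreal (real (N s \<omega>) * real (N s \<omega>)) +
        of_nat (N s \<omega>) * (\<Sum>j=N s \<omega>..<N t \<omega>. 1)"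
      by (simp add: ennreal_of_nat_eq_real_of_nat flip: ennreal_mult ennreal_plus)
  qed
  also have "\<dots> = ennreal (second_moment s) +
      (\<integral>\<^sup>+\<omega>. of_nat (N s \<omega>) * (\<Sum>j=N s \<omega>..<N t \<omega>. 1) \<partial>M)"
    using assms nn[OF order.refl]
    by (subst nn_integral_add) (auto simp: mixed_moment_self)
  also have "(\<integral>\<^sup>+\<omega>. of_nat (N s \<omega>) * (\<Sum>j=N s \<omega>..<N t \<omega>. 1) \<partial>M) =
      (\<integral>\<^sup>+u\<in>{s<..t}. (\<integral>\<^sup>+\<omega>. of_nat (N s \<omega>) * (1 * ennreal (rate u (N u \<omega>))) \<partial>M) \<partial>lborel)"
    by (rule intensity_formula[OF assms])
  also have "\<dots> = (\<integral>\<^sup>+u\<in>{s<..t}. ennreal (\<beta> * mean s + \<alpha> / (u + 1) * mixed_moment s u) \<partial>lborel)"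
  proof (rule nn_integral_cong_on)
    fix u assume "u \<in> {s<..t}"
    then have u: "0 \<le> u" "s \<le> u" using assms by auto
    let ?r = "\<lambda>\<omega>. \<beta> * real (N s \<omega>) + \<alpha> / (u + 1) * (real (N s \<omega>) * real (N u \<omega>))"
    have r: "of_nat (N s \<omega>) * (1 * ennreal (rate u (N u \<omega>))) = ennreal (?r \<omega>)" for \<omega>
    proof -
      have "of_nat (N s \<omega>) * ennreal (rate u (N u \<omega>)) = ennreal (real (N s \<omega>) * rate u (N u \<omega>))"
        by (simp only: ennreal_of_nat_eq_real_of_nat ennreal_mult' of_nat_0_le_iff)
      also have "real (N s \<omega>) * rate u (N u \<omega>) = ?r \<omega>"
        by (simp add: rate_def algebra_simps)
      finally show ?thesis by simp
    qed
    have "(\<integral>\<^sup>+\<omega>. ennreal (?r \<omega>) \<partial>M) = ennreal (\<integral>\<omega>. ?r \<omega> \<partial>M)"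
      using integrable_N[OF assms(1)] integrable_N_mult[OF assms(1) u(2)] u \<alpha>_pos \<beta>_pos
      by (intro nn_integral_eq_integral) auto
    also have "(\<integral>\<omega>. ?r \<omega> \<partial>M) = \<beta> * mean s + \<alpha> / (u + 1) * mixed_moment s u"
      unfolding mean_def mixed_moment_def
      using integrable_N[OF assms(1)] integrable_N_mult[OF assms(1) u(2)] by simp
    finally show "(\<integral>\<^sup>+\<omega>. of_nat (N s \<omega>) * (1 * ennreal (rate u (N u \<omega>))) \<partial>M) =
        ennreal (\<beta> * mean s + \<alpha> / (u + 1) * mixed_moment s u)"
      unfolding r .
  qed
  finally show ?thesis .
qed

subsection \<open>Covariance\<close>

lemma covariance_N_eq_moments:
  assumes "0 \<le> s" "s \<le> t"
  shows "covariance M (\<lambda>\<omega>. real (N t \<omega>)) (\<lambda>\<omega>. real (N s \<omega>)) = mixed_moment s t - mean s * mean t"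
proof -
  have t: "0 \<le> t" using assms by simp
  have "covariance M (\<lambda>\<omega>. real (N t \<omega>)) (\<lambda>\<omega>. real (N s \<omega>)) =
      (\<integral>\<omega>. real (N s \<omega>) * real (N t \<omega>) - mean s * real (N t \<omega>) - mean t * real (N s \<omega>)
        + mean s * mean t \<partial>M)"
    unfolding covariance_def mean_def[symmetric]
    by (intro Bochner_Integration.integral_cong) (auto simp: algebra_simps)
  also have "\<dots> = mixed_moment s t - mean s * mean t - mean t * mean s + mean s * mean t"
    using integrable_N_mult[OF assms] integrable_N[OF assms(1)] integrable_N[OF t]
    by (simp add: prob_space mixed_moment_def flip: mean_def)
  finally show ?thesis by simp
qed

text \<open>It suffices to exhibit solutions \<open>m\<close> and \<open>v\<close> of the mean and
  variance equations: uniqueness identifies the three moments in turn, each equation using the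
  moments found before.\<close>

lemma covariance_N_eq:
  fixes m v :: "real \<Rightarrow> real"
  assumes m0: "m 0 = 0" and v0: "v 0 = 0"
    and m: "\<And>t. 0 \<le> t \<Longrightarrow> (m has_real_derivative \<beta> + \<alpha> / (t + 1) * m t) (at t)"
    and v: "\<And>t. 0 \<le> t \<Longrightarrow>
      (v has_real_derivative \<beta> + \<alpha> / (t + 1) * m t + 2 * \<alpha> / (t + 1) * v t) (at t)"
    and s: "0 \<le> s" and st: "s \<le> t"
  shows "covariance M (\<lambda>\<omega>. real (N t \<omega>)) (\<lambda>\<omega>. real (N s \<omega>)) =
    (t + 1) powr \<alpha> / (s + 1) powr \<alpha> * v s"
proof -
  have mean: "mean t = m t" if "0 \<le> t" for t
  proof (rule linear_integral_equation_unique[where p = "\<lambda>_. \<beta>" and q = "\<lambda>s. \<alpha> / (s + 1)", OF mean_mono])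
    show "continuous_on {0..} (\<lambda>s. \<alpha> / (s + 1))" by (intro continuous_intros) auto
    show "ennreal (mean t) = ennreal (mean 0) +
        (\<integral>\<^sup>+s\<in>{0<..t}. ennreal (\<beta> + \<alpha> / (s + 1) * mean s) \<partial>lborel)" if "0 \<le> t" for t
      using mean_integral_equation[OF that] by (simp add: mean_0)
  qed (use m m0 mean_0 moment_nonneg \<alpha>_pos \<beta>_pos that in auto)
  have m_cont: "continuous_on {0..} m"
    using m by (intro continuous_at_imp_continuous_on) (auto intro: DERIV_isCont)
  have second: "second_moment t = v t + (m t)\<^sup>2" if "0 \<le> t" for t
  proof (rule linear_integral_equation_unique[where p = "\<lambda>s. \<beta> + (2 * \<beta> + \<alpha> / (s + 1)) * m s"
        and q = "\<lambda>s. 2 * \<alpha> / (s + 1)", OF second_moment_mono])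
    show "continuous_on {0..} (\<lambda>s. \<beta> + (2 * \<beta> + \<alpha> / (s + 1)) * m s)"
      by (intro continuous_intros m_cont) auto
    show "continuous_on {0..} (\<lambda>s. 2 * \<alpha> / (s + 1))" by (intro continuous_intros) auto
    show "ennreal (second_moment t) = ennreal (second_moment 0) + (\<integral>\<^sup>+s\<in>{0<..t}.
        ennreal (\<beta> + (2 * \<beta> + \<alpha> / (s + 1)) * m s + 2 * \<alpha> / (s + 1) * second_moment s) \<partial>lborel)"
      if "0 \<le> t" for t
      unfolding second_moment_integral_equation[OF that] second_moment_0 ennreal_0 add_0
      by (intro nn_integral_cong_on) (auto simp: mean)
    show "((\<lambda>t. v t + (m t)\<^sup>2) has_real_derivative \<beta> + (2 * \<beta> + \<alpha> / (t + 1)) * m t +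
        2 * \<alpha> / (t + 1) * (v t + (m t)\<^sup>2)) (at t)" if "0 \<le> t" for t
      by (rule derivative_eq_intros m v that refl)+ (simp add: algebra_simps add_divide_distrib power2_eq_square)
    show "0 \<le> \<beta> + (2 * \<beta> + \<alpha> / (s + 1)) * m s + 2 * \<alpha> / (s + 1) * second_moment s" if "0 \<le> s" for s
      using moment_nonneg mean[OF that, symmetric] \<alpha>_pos \<beta>_pos that by simp
  qed (use m0 v0 second_moment_0 that in auto)
  \<comment> \<open>The product of means is a particular solution for t \<ge> s, and multiples of (t
    + 1)^\<alpha> solve the homogeneous equation. The value at t = s fixes the multiple through the
    variance \<open>v s\<close>.\<close>
  have "mixed_moment s t = m s * m t + (t + 1) powr \<alpha> / (s + 1) powr \<alpha> * v s"
  proof (rule linear_integral_equation_unique[where p = "\<lambda>_. \<beta> * m s" and q = "\<lambda>s. \<alpha> / (s + 1)",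
        OF mixed_moment_mono[OF s]])
    show "continuous_on {s..} (\<lambda>u. \<alpha> / (u + 1))" using s by (intro continuous_intros) auto
    show "ennreal (mixed_moment s t) = ennreal (mixed_moment s s) +
        (\<integral>\<^sup>+u\<in>{s<..t}. ennreal (\<beta> * m s + \<alpha> / (u + 1) * mixed_moment s u) \<partial>lborel)" if "s \<le> t" for t
      using mixed_moment_integral_equation[OF s that] by (simp add: mean[OF s] mixed_moment_self)
    show "((\<lambda>t. m s * m t + (t + 1) powr \<alpha> / (s + 1) powr \<alpha> * v s) has_real_derivative
        \<beta> * m s + \<alpha> / (t + 1) * (m s * m t + (t + 1) powr \<alpha> / (s + 1) powr \<alpha> * v s)) (at t)"
      if t: "s \<le> t" for t
    proof -
      have "0 \<le> t" using s t by simp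
      from DERIV_add[OF DERIV_cmult[OF m[OF this]]
          DERIV_cmult_right[OF DERIV_cdivide[OF has_real_derivative_powr_shift[OF this]]]]
      show ?thesis by (rule DERIV_cong) (simp add: algebra_simps add_divide_distrib)
    qed
    show "0 \<le> \<beta> * m s + \<alpha> / (u + 1) * mixed_moment s u" if "s \<le> u" for u
      using moment_nonneg mean[OF s, symmetric] \<alpha>_pos \<beta>_pos s that by simp
    show "m s * m s + (s + 1) powr \<alpha> / (s + 1) powr \<alpha> * v s = mixed_moment s s"
      using s second[OF s] by (simp add: mixed_moment_self power2_eq_square)
  qed (use st moment_nonneg in auto)
  then show ?thesis
    using covariance_N_eq_moments[OF s st] mean s st by simp
qed

end

section \<open>Explicit solutions and the closed forms of the covariance\<close>

theorem proposition19:
  fixes M :: "'a measure" and N :: "real \<Rightarrow> 'a \<Rightarrow> nat" and \<alpha> \<beta> :: real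
  assumes "prob_space M"
    and "\<alpha> > 0" and "\<beta> > 0"
    and "simple_point_process M N"
    and "has_intensity M (natural_filtration M N) N
           (\<lambda>t \<omega>. \<beta> + \<alpha> * (real (left_limit N t \<omega>) / (t + 1)))"
  shows "(\<forall>t\<ge>0. integrable M (\<lambda>\<omega>. (real (N t \<omega>))\<^sup>2)) \<and>
         (\<alpha> \<notin> {1/2, 1} \<longrightarrow> (\<forall>t s. t > s \<and> s \<ge> 0 \<longrightarrow>
           covariance M (\<lambda>\<omega>. real (N t \<omega>)) (\<lambda>\<omega>. real (N s \<omega>)) =
             (t + 1) powr \<alpha> *
               (\<beta> / ((1 - 2 * \<alpha>) * (1 - \<alpha>)) * (s + 1) powr (1 - \<alpha>)
                + \<beta> / (1 - \<alpha>)
                - 2 * \<beta> / (1 - 2 * \<alpha>) * (s + 1) powr \<alpha>))) \<and>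
         (\<alpha> = 1/2 \<longrightarrow> (\<forall>t s. t > s \<and> s \<ge> 0 \<longrightarrow>
           covariance M (\<lambda>\<omega>. real (N t \<omega>)) (\<lambda>\<omega>. real (N s \<omega>)) =
             2 * \<beta> *
               (- ((t + 1) powr (1/2) * (s + 1) powr (1/2))
                + (t + 1) powr (1/2)
                + (t + 1) powr (1/2) * (s + 1) powr (1/2) * ln (s + 1))))"
proof -
  interpret prob_space M by fact
  interpret self_exciting M N \<alpha> \<beta>
    using assms by unfold_locales
  \<comment> \<open>The mean for \<alpha> different from 1, which covers both formulas.\<close>
  define m where "m t = \<beta> / (1 - \<alpha>) * (t + 1 - (t + 1) powr \<alpha>)" for t :: real
  have m: "(m has_real_derivative \<beta> + \<alpha> / (t + 1) * m t) (at t)" if "0 \<le> t" "\<alpha> \<noteq> 1" for t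
    unfolding m_def
    by (rule derivative_eq_intros has_real_derivative_powr_shift that refl)+
      (use that in \<open>simp add: divide_simps, simp add: algebra_simps\<close>)
  show ?thesis
  proof (intro conjI impI allI; (elim conjE)?)
    show "integrable M (\<lambda>\<omega>. (real (N t \<omega>))\<^sup>2)" if "0 \<le> t" for t
      using integrable_N_square that by simp
  next
    fix t s :: real assume \<alpha>: "\<alpha> \<notin> {1/2, 1}" and st: "s < t" "0 \<le> s"
    \<comment> \<open>The forcing term \<open>m'\<close> yields particular solutions in (u + 1) and
      (u + 1)^\<alpha>; the coefficient of the homogeneous solution (u + 1)^(2 \<alpha>) is fixed by
      \<open>v 0 = 0\<close>.\<close>
    define v where "v u = \<beta> / ((1 - 2 * \<alpha>) * (1 - \<alpha>)) * (u + 1) + \<beta> / (1 - \<alpha>) * (u + 1) powr \<alpha>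
      - 2 * \<beta> / (1 - 2 * \<alpha>) * (u + 1) powr (2 * \<alpha>)" for u :: real
    have nz: "1 - \<alpha> \<noteq> 0" "1 - 2 * \<alpha> \<noteq> 0" using \<alpha> by auto
    have v: "(v has_real_derivative \<beta> + \<alpha> / (u + 1) * m u + 2 * \<alpha> / (u + 1) * v u) (at u)"
      if "0 \<le> u" for u
      unfolding v_def m_def
      by (rule derivative_eq_intros has_real_derivative_powr_shift that refl)+
        (use that nz in \<open>simp add: divide_simps, simp add: algebra_simps\<close>)
    have "covariance M (\<lambda>\<omega>. real (N t \<omega>)) (\<lambda>\<omega>. real (N s \<omega>)) = (t + 1) powr \<alpha> / (s + 1) powr \<alpha> * v s"
    proof (rule covariance_N_eq[OF _ _ m v])
      show "v 0 = 0" using nz by (simp add: v_def divide_simps) (simp add: algebra_simps)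
    qed (use \<alpha> st in \<open>auto simp: m_def\<close>)
    also have "v s = (s + 1) powr \<alpha> * (\<beta> / ((1 - 2 * \<alpha>) * (1 - \<alpha>)) * (s + 1) powr (1 - \<alpha>)
                + \<beta> / (1 - \<alpha>) - 2 * \<beta> / (1 - 2 * \<alpha>) * (s + 1) powr \<alpha>)"
    proof -
      have "(s + 1) powr \<alpha> * (s + 1) powr (1 - \<alpha>) = s + 1"
        "(s + 1) powr \<alpha> * (s + 1) powr \<alpha> = (s + 1) powr (2 * \<alpha>)"
        using st by (simp_all flip: powr_add)
      moreover have "A * z + B * x - C * w = x * (A * y + B - C * x)"
        if "x * y = z" "x * x = w" for A B C w x y z :: real
        unfolding that[symmetric] by (simp add: algebra_simps)
      ultimately show ?thesis unfolding v_def by blast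
    qed
    finally show "covariance M (\<lambda>\<omega>. real (N t \<omega>)) (\<lambda>\<omega>. real (N s \<omega>)) = (t + 1) powr \<alpha> *
        (\<beta> / ((1 - 2 * \<alpha>) * (1 - \<alpha>)) * (s + 1) powr (1 - \<alpha>) + \<beta> / (1 - \<alpha>)
          - 2 * \<beta> / (1 - 2 * \<alpha>) * (s + 1) powr \<alpha>)"
      using st by simp
  next
    fix t s :: real assume \<alpha>: "\<alpha> = 1/2" and st: "s < t" "0 \<le> s"
    \<comment> \<open>Resonance: for \<alpha> = 1/2 the homogeneous solution is u + 1 itself, so the
      constant part of the forcing term produces the logarithm.\<close>
    define v where "v u = 2 * \<beta> * ((u + 1) * ln (u + 1) + (u + 1) powr (1/2) - (u + 1))" for u :: real
    have v: "(v has_real_derivative \<beta> + \<alpha> / (u + 1) * m u + 2 * \<alpha> / (u + 1) * v u) (at u)"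
      if "0 \<le> u" for u
    proof -
      have ln: "((\<lambda>u. ln (u + 1)) has_real_derivative 1 / (u + 1)) (at u)"
        using that by (auto intro!: derivative_eq_intros)
      show ?thesis
        unfolding v_def m_def \<alpha>
        by (rule ln has_real_derivative_powr_shift[OF that] derivative_eq_intros refl)+
          (use that in \<open>simp add: divide_simps, simp add: algebra_simps\<close>)
    qed
    have "covariance M (\<lambda>\<omega>. real (N t \<omega>)) (\<lambda>\<omega>. real (N s \<omega>)) = (t + 1) powr \<alpha> / (s + 1) powr \<alpha> * v s"
      by (rule covariance_N_eq[OF _ _ m v]) (use \<alpha> st in \<open>auto simp: m_def v_def\<close>)
    also have "v s = (s + 1) powr \<alpha> * (2 * \<beta> * ((s + 1) powr \<alpha> * ln (s + 1) + 1 - (s + 1) powr \<alpha>))"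
    proof -
      have "(s + 1) powr (1/2) * (s + 1) powr (1/2) = s + 1"
        using st by (simp flip: powr_add)
      then show ?thesis unfolding v_def \<alpha> by algebra
    qed
    finally show "covariance M (\<lambda>\<omega>. real (N t \<omega>)) (\<lambda>\<omega>. real (N s \<omega>)) = 2 * \<beta> *
        (- ((t + 1) powr (1/2) * (s + 1) powr (1/2)) + (t + 1) powr (1/2)
          + (t + 1) powr (1/2) * (s + 1) powr (1/2) * ln (s + 1))"
      using st \<alpha> by (simp add: algebra_simps)
  qed
qed

end
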